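(* For every nontrivial finite simple connected graph $G$, $$DSO(G)\ge \frac{SO(G)^2}{\sqrt{2}\,F(G)}.$$ Equality holds if and only if $G$ is regular.
   Context: For a finite simple graph $G=(V(G),E(G))$, $d_u$ denotes the degree of the vertex $u$. A connected graph is nontrivial if it has at least two vertices (equivalently, at least one edge). The Diminished Sombor index is $DSO(G)=\sum_{uv\in E(G)}\frac{\sqrt{d_u^2+d_v^2}}{d_u+d_v}$. The Sombor index is $SO(G)=\sum_{uv\in E(G)}\sqrt{d_u^2+d_v^2}$ and the forgotten index is $F(G)=\sum_{uv\in E(G)}(d_u^2+d_v^2)$. *)

theory Defs
  imports Complex_Main "Graph_Theory.Digraph" "Graph_Theory.Digraph_Component"
begin

text \<open>
  Finite simple graphs are the symmetric, loop-free digraphs without parallel arcs of the locale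
  \<^locale>\<open>graph\<close>. There an undirected edge \<open>uv\<close> is a pair of opposite arcs, so the sums over
  \<open>E(G)\<close> must not range over \<^term>\<open>arcs G\<close>, which would count each edge twice.
\<close>

definition uedges :: "('a, 'b) pre_digraph \<Rightarrow> 'a set set" where
  "uedges G = (\<lambda>a. {tail G a, head G a}) ` arcs G"

text \<open>In a \<^locale>\<open>graph\<close>, every edge at \<open>u\<close> gives exactly one arc with tail \<open>u\<close>.\<close>

abbreviation deg :: "('a, 'b) pre_digraph \<Rightarrow> 'a \<Rightarrow> nat" where
  "deg G u \<equiv> out_degree G u"

definition regular :: "('a, 'b) pre_digraph \<Rightarrow> bool" where
  "regular G \<longleftrightarrow> (\<exists>k. \<forall>v \<in> verts G. deg G v = k)"

text \<open>
  An edge is a two-element set \<open>e = {u, v}\<close>, so a symmetric expression such as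
  \<open>d\<^sub>u\<^sup>2 + d\<^sub>v\<^sup>2\<close> is the sum over the elements of \<open>e\<close>; compare the lemma \<open>sum_uedge\<close> below.
\<close>

definition DSO :: "('a, 'b) pre_digraph \<Rightarrow> real" where
  "DSO G = (\<Sum>e \<in> uedges G. sqrt (\<Sum>u \<in> e. (real (deg G u))\<^sup>2) / (\<Sum>u \<in> e. real (deg G u)))"

definition SO :: "('a, 'b) pre_digraph \<Rightarrow> real" where
  "SO G = (\<Sum>e \<in> uedges G. sqrt (\<Sum>u \<in> e. (real (deg G u))\<^sup>2))"

definition forgotten_index :: "('a, 'b) pre_digraph \<Rightarrow> real" where
  "forgotten_index G = (\<Sum>e \<in> uedges G. \<Sum>u \<in> e. (real (deg G u))\<^sup>2)"

lemma sum_uedge: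
  fixes f :: "'a \<Rightarrow> real"
  assumes "Digraph.graph G" and "a \<in> arcs G"
  shows "(\<Sum>u \<in> {tail G a, head G a}. f u) = f (tail G a) + f (head G a)"
proof -
  interpret Digraph.graph G by (rule assms(1))
  show ?thesis using no_loops[OF assms(2)] by simp
qed

lemma deg_eq_card_uedges:
  assumes "Digraph.graph G"
  shows "deg G u = card {e \<in> uedges G. u \<in> e}"
proof -
  interpret Digraph.graph G by (rule assms)
  have "inj_on (\<lambda>a. {tail G a, head G a}) (out_arcs G u)"
    by (rule inj_onI) (auto simp: doubleton_eq_iff arc_to_ends_def intro!: no_multi_arcs)
  moreover have "(\<lambda>a. {tail G a, head G a}) ` out_arcs G u = {e \<in> uedges G. u \<in> e}"
  proof (intro equalityI subsetI)
    fix e assume "e \<in> {e \<in> uedges G. u \<in> e}"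
    then obtain a where a: "a \<in> arcs G" "e = {tail G a, head G a}" "u \<in> e"
      by (auto simp: uedges_def)
    obtain b where b: "b \<in> arcs G" "tail G a = head G b" "head G a = tail G b"
      using sym_arcs a(1) unfolding symmetric_conv by blast
    show "e \<in> (\<lambda>a. {tail G a, head G a}) ` out_arcs G u"
    proof (cases "u = tail G a")
      case True
      with a show ?thesis by (intro image_eqI[of _ _ a]) auto
    next
      case False
      with a b show ?thesis by (intro image_eqI[of _ _ b]) auto
    qed
  qed (auto simp: uedges_def)
  ultimately show ?thesis
    unfolding out_degree_def by (metis card_image)
qed

end

theory Submission
  imports Defs "HOL-Analysis.Convex"
begin

text \<open>
  Both sides are compared with \<open>m / \<surd>2\<close>, where \<open>m\<close> is the number of edges.

  Each summand of \<open>DSO(G)\<close> is a ratio \<open>sqrt (x\<^sup>2 + y\<^sup>2) / (x + y)\<close> of positive numbers,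
  which is at least \<open>1 / \<surd>2\<close> with equality exactly for \<open>x = y\<close>. Hence \<open>DSO(G) \<ge> m / \<surd>2\<close>, with
  equality exactly if adjacent vertices have equal degrees, and for connected \<open>G\<close> this means that
  \<open>G\<close> is regular (lemmas \<open>DSO_ge\<close>, \<open>DSO_eq_iff\<close>, \<open>regular_iff_arcs\<close>).

  The Cauchy--Schwarz inequality for the numbers \<open>sqrt (d\<^sub>u\<^sup>2 + d\<^sub>v\<^sup>2)\<close> gives
  \<open>SO(G)\<^sup>2 \<le> m F(G)\<close>, that is, \<open>SO(G)\<^sup>2 / (\<surd>2 F(G)) \<le> m / \<surd>2\<close> (lemma \<open>SO_squared_le\<close>).

  If \<open>DSO(G) = SO(G)\<^sup>2 / (\<surd>2 F(G))\<close>, then the value \<open>m / \<surd>2\<close> between the two is attained by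
  \<open>DSO(G)\<close>, so \<open>G\<close> is regular. If \<open>G\<close> is regular, then all the numbers in the Cauchy--Schwarz
  inequality are equal, so that both steps are equalities.
\<close>

text \<open>
  The identity \<open>2 (x\<^sup>2 + y\<^sup>2) = (x + y)\<^sup>2 + (x - y)\<^sup>2\<close> yields the bound and shows that its defect is
  due to \<open>x - y\<close> alone.
\<close>

lemma sqrt_sum_squares_div_sum:
  fixes x y :: real
  assumes "0 < x" and "0 < y"
  shows "1 / sqrt 2 \<le> sqrt (x\<^sup>2 + y\<^sup>2) / (x + y)"
    and "sqrt (x\<^sup>2 + y\<^sup>2) / (x + y) = 1 / sqrt 2 \<longleftrightarrow> x = y"
proof -
  have gap: "2 * (x\<^sup>2 + y\<^sup>2) = (x + y)\<^sup>2 + (x - y)\<^sup>2"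
    by (simp add: power2_eq_square algebra_simps)
  have root: "sqrt 2 * sqrt (x\<^sup>2 + y\<^sup>2) = sqrt ((x + y)\<^sup>2 + (x - y)\<^sup>2)"
    unfolding gap[symmetric] by (rule real_sqrt_mult[symmetric])
  have "x + y \<le> sqrt 2 * sqrt (x\<^sup>2 + y\<^sup>2)"
    unfolding root by (rule real_le_rsqrt) simp
  then show "1 / sqrt 2 \<le> sqrt (x\<^sup>2 + y\<^sup>2) / (x + y)"
    using assms by (simp add: field_simps)
  have "sqrt (x\<^sup>2 + y\<^sup>2) / (x + y) = 1 / sqrt 2 \<longleftrightarrow> sqrt 2 * sqrt (x\<^sup>2 + y\<^sup>2) = x + y"
    using assms by (auto simp: field_simps)
  also have "\<dots> \<longleftrightarrow> sqrt ((x + y)\<^sup>2 + (x - y)\<^sup>2) = sqrt ((x + y)\<^sup>2)"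
    unfolding root using assms by simp
  also have "\<dots> \<longleftrightarrow> x = y"
    unfolding real_sqrt_eq_iff by simp
  finally show "sqrt (x\<^sup>2 + y\<^sup>2) / (x + y) = 1 / sqrt 2 \<longleftrightarrow> x = y" .
qed

lemma connected_locally_constant:
  assumes "Digraph.graph G" and "Digraph_Component.connected G"
    and eq: "\<And>a. a \<in> arcs G \<Longrightarrow> f (tail G a) = f (head G a)"
    and "u \<in> verts G" and "v \<in> verts G"
  shows "f u = f v"
proof -
  interpret Digraph.graph G by (rule assms(1))
  have "strongly_connected G"
    using sym_arcs assms(2) by (rule symmetric_connected_imp_strongly_connected)
  then have "u \<rightarrow>\<^sup>*\<^bsub>G\<^esub> v"
    using assms(4,5) by (simp add: strongly_connected_def)
  then show ?thesis
    by (induction rule: reachable_induct) (auto dest: eq)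
qed

text \<open>
  Without arcs every function on the vertices would be locally constant, even the identity, so that
  \<open>G\<close> would have a single vertex.
\<close>

lemma connected_uedges_nonempty:
  assumes "Digraph.graph G" and "Digraph_Component.connected G" and "card (verts G) \<ge> 2"
  shows "uedges G \<noteq> {}"
proof
  assume "uedges G = {}"
  then have "u = v" if "u \<in> verts G" "v \<in> verts G" for u v
    using connected_locally_constant[OF assms(1,2), of "\<lambda>w. w"] that by (simp add: uedges_def)
  then have "card (verts G) \<le> 1"
    by (metis One_nat_def card_le_Suc0_iff_eq card.infinite zero_le)
  with assms(3) show False by simp
qed

lemma regular_iff_arcs:
  assumes "Digraph.graph G" and "Digraph_Component.connected G"
  shows "regular G \<longleftrightarrow> (\<forall>a \<in> arcs G. deg G (tail G a) = deg G (head G a))"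
proof
  interpret Digraph.graph G by (rule assms(1))
  assume "regular G"
  then show "\<forall>a \<in> arcs G. deg G (tail G a) = deg G (head G a)"
    by (auto simp: regular_def)
next
  assume "\<forall>a \<in> arcs G. deg G (tail G a) = deg G (head G a)"
  then have "deg G u = deg G v" if "u \<in> verts G" "v \<in> verts G" for u v
    using connected_locally_constant[OF assms, of "deg G"] that by blast
  then show "regular G"
    unfolding regular_def by blast
qed

lemma finite_uedges:
  assumes "Digraph.graph G"
  shows "finite (uedges G)"
proof -
  interpret Digraph.graph G by (rule assms)
  show ?thesis by (simp add: uedges_def)
qed

text \<open>
  The degree of a vertex counts the edges that contain it, so the edge of the arc \<open>a\<close> contributes to
  the degree of its head as well as of its tail.
\<close>

lemma deg_endpoints_pos:
  assumes "Digraph.graph G" and "a \<in> arcs G"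
  shows "0 < deg G (tail G a)" and "0 < deg G (head G a)"
proof -
  have "{tail G a, head G a} \<in> uedges G"
    using assms(2) by (simp add: uedges_def)
  then show "0 < deg G (tail G a)" and "0 < deg G (head G a)"
    unfolding deg_eq_card_uedges[OF assms(1)]
    by (auto simp: card_gt_0_iff finite_uedges[OF assms(1)])
qed

lemma edge_summand_ge:
  assumes "Digraph.graph G" and "e \<in> uedges G"
  shows "1 / sqrt 2 \<le> sqrt (\<Sum>u \<in> e. (real (deg G u))\<^sup>2) / (\<Sum>u \<in> e. real (deg G u))"
  using assms(2) deg_endpoints_pos[OF assms(1)]
  by (auto simp: uedges_def sum_uedge[OF assms(1)] simp del: sum.insert
      intro!: sqrt_sum_squares_div_sum(1))

lemma DSO_ge:
  assumes "Digraph.graph G"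
  shows "real (card (uedges G)) / sqrt 2 \<le> DSO G"
  using sum_mono[OF edge_summand_ge[OF assms], of "uedges G"] by (simp add: DSO_def)

lemma DSO_eq_iff:
  assumes "Digraph.graph G"
  shows "DSO G = real (card (uedges G)) / sqrt 2 \<longleftrightarrow>
    (\<forall>a \<in> arcs G. deg G (tail G a) = deg G (head G a))"
proof -
  let ?q = "\<lambda>e. sqrt (\<Sum>u \<in> e. (real (deg G u))\<^sup>2) / (\<Sum>u \<in> e. real (deg G u))"
  have "DSO G = real (card (uedges G)) / sqrt 2 \<longleftrightarrow>
      (\<Sum>e \<in> uedges G. 1 / sqrt 2) = (\<Sum>e \<in> uedges G. ?q e)"
    by (auto simp: DSO_def)
  also have "\<dots> \<longleftrightarrow> (\<forall>e \<in> uedges G. ?q e = 1 / sqrt 2)"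
  proof
    assume eq: "(\<Sum>e \<in> uedges G. 1 / sqrt 2) = (\<Sum>e \<in> uedges G. ?q e)"
    show "\<forall>e \<in> uedges G. ?q e = 1 / sqrt 2"
      using sum_mono_inv[OF eq edge_summand_ge[OF assms] _ finite_uedges[OF assms]] by simp
  qed simp
  also have "\<dots> \<longleftrightarrow> (\<forall>a \<in> arcs G. ?q {tail G a, head G a} = 1 / sqrt 2)"
    by (simp add: uedges_def)
  also have "\<dots> \<longleftrightarrow> (\<forall>a \<in> arcs G. deg G (tail G a) = deg G (head G a))"
  proof (rule ball_cong[OF refl])
    fix a assume "a \<in> arcs G"
    with deg_endpoints_pos[OF assms this]
    show "?q {tail G a, head G a} = 1 / sqrt 2 \<longleftrightarrow> deg G (tail G a) = deg G (head G a)"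
      by (simp add: sum_uedge[OF assms] sqrt_sum_squares_div_sum(2) del: sum.insert)
  qed
  finally show ?thesis .
qed

text \<open>This form of \<open>F(G)\<close> makes it the sum of squares that Cauchy--Schwarz pairs with \<open>SO(G)\<close>.\<close>

lemma forgotten_index_eq:
  "forgotten_index G = (\<Sum>e \<in> uedges G. (sqrt (\<Sum>u \<in> e. (real (deg G u))\<^sup>2))\<^sup>2)"
  by (simp add: forgotten_index_def sum_nonneg)

lemma SO_squared_le: "(SO G)\<^sup>2 \<le> real (card (uedges G)) * forgotten_index G"
  using sum_squared_le_sum_of_squares[of _ "uedges G"]
  by (simp add: SO_def forgotten_index_eq mult.commute)

text \<open>In a regular graph all summands of \<open>SO(G)\<close> are equal, which makes Cauchy--Schwarz sharp.\<close>

lemma SO_squared_regular: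
  assumes "Digraph.graph G" and "regular G"
  shows "(SO G)\<^sup>2 = real (card (uedges G)) * forgotten_index G"
proof -
  interpret Digraph.graph G by (rule assms(1))
  obtain k where k: "\<And>v. v \<in> verts G \<Longrightarrow> deg G v = k"
    using assms(2) by (auto simp: regular_def)
  have "(\<Sum>u \<in> e. (real (deg G u))\<^sup>2) = 2 * (real k)\<^sup>2" if "e \<in> uedges G" for e
    using that by (auto simp: uedges_def sum_uedge[OF assms(1)] k simp del: sum.insert)
  then show ?thesis
    by (simp add: SO_def forgotten_index_def power2_eq_square)
qed

lemma forgotten_index_pos:
  assumes "Digraph.graph G" and "uedges G \<noteq> {}"
  shows "0 < forgotten_index G"
  unfolding forgotten_index_def
proof (rule sum_pos[OF finite_uedges[OF assms(1)] assms(2)])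
  fix e assume "e \<in> uedges G"
  then show "0 < (\<Sum>u \<in> e. (real (deg G u))\<^sup>2)"
    using deg_endpoints_pos[OF assms(1)]
    by (auto simp: uedges_def sum_uedge[OF assms(1)] simp del: sum.insert intro!: add_pos_pos)
qed

theorem corollary2:
  fixes G :: "('a, 'b) pre_digraph"
  assumes "Digraph.graph G"
    and "Digraph_Component.connected G"
    and "card (verts G) \<ge> 2"
  shows "DSO G \<ge> (SO G)\<^sup>2 / (sqrt 2 * forgotten_index G) \<and>
    (DSO G = (SO G)\<^sup>2 / (sqrt 2 * forgotten_index G) \<longleftrightarrow> regular G)"
proof -
  let ?m = "real (card (uedges G))" and ?R = "(SO G)\<^sup>2 / (sqrt 2 * forgotten_index G)"
  have F: "0 < forgotten_index G"
    using assms(1) connected_uedges_nonempty[OF assms] by (rule forgotten_index_pos)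
  have lower: "?R \<le> ?m / sqrt 2"
    using SO_squared_le[of G] F by (simp add: field_simps)
  have upper: "?m / sqrt 2 \<le> DSO G"
    using assms(1) by (rule DSO_ge)
  have regular: "DSO G = ?m / sqrt 2 \<longleftrightarrow> regular G"
    using DSO_eq_iff[OF assms(1)] regular_iff_arcs[OF assms(1,2)] by simp
  have "?R = ?m / sqrt 2" if "regular G"
    using SO_squared_regular[OF assms(1) that] F by simp
  with lower upper regular show ?thesis by auto
qed

end
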